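(* Let $s\geq 1$, $d\geq 1$ and $m\geq 2$ be integers with $m\geq sd$, and let $n=m-1$. Let $\mathcal{C}_m^{s,d}$ be the set of circular preferences (assignments of an admissible $s$-tuple to each of the $n$ cars) and, for $A\in\mathcal{C}_m^{s,d}$, let $E(A)\in\mathbb{Z}_m$ be the unique spot left empty after circular parking. Then for every spot $j\in\mathbb{Z}_m$, $$\bigl|\{A\in\mathcal{C}_m^{s,d}:\ E(A)=j\}\bigr|=m^{\,n-1}\binom{m-sd+s-1}{s-1}^{n}.$$
   Context: Let $m\geq 2$. The spots are the elements of $\mathbb{Z}_m=\{1,\dots,m\}$, arranged clockwise on a circle. For $x\in\mathbb{Z}_m$ and an integer $k\geq 0$, $x\oplus k$ denotes clockwise displacement of $x$ by $k$, i.e. addition modulo $m$. Admissible tuples: fix integers $s\geq 1$ and $d\geq 1$. An admissible $s$-tuple is a tuple $(a_1,\dots,a_s)=\bigl(a,\ a\oplus k_1,\ a\oplus(k_1+k_2),\ \dots,\ a\oplus(k_1+\cdots+k_{s-1})\bigr)$ with $a\in\mathbb{Z}_m$ (the anchor) and integers $k_i\geq d$ for $1\le i\le s-1$ (the increments) such that $k_1+\cdots+k_{s-1}\leq m-d$ (for $s=1$ the sum is empty and equals $0$). Circular parking: let $n=m-1$. Cars $c_1,\dots,c_n$ enter in this order, each carrying an admissible $s$-tuple; all spots are initially free. Each car tries the spots of its tuple in the order $a_1,a_2,\dots,a_s$ and parks in the first one that is free; if all of them are occupied, it sweeps clockwise starting from its last choice $a_s$ (visiting $a_s\oplus 1, a_s\oplus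 2,\dots$) and parks in the first free spot. A circular preference $A$ is a choice of an admissible $s$-tuple for each of the $n$ cars; the set of circular preferences is $\mathcal{C}_m^{s,d}$. Since $n<m$, every car parks and exactly one spot, denoted $E(A)$, remains empty. *)

theory Defs
  imports Main
begin

text \<open>
  Spots are the representatives \<open>1, \<dots>, m\<close> of the residues modulo \<open>m\<close>; clockwise displacement
  is addition modulo \<open>m\<close>, with values in \<open>{1..m}\<close>.
\<close>

definition spots :: "nat \<Rightarrow> nat set" where
  "spots m = {1..m}"

definition cw :: "nat \<Rightarrow> nat \<Rightarrow> nat \<Rightarrow> nat" where
  "cw m x k = (x - 1 + k) mod m + 1"

definition tuple_of :: "nat \<Rightarrow> nat \<Rightarrow> nat list \<Rightarrow> nat list" where
  "tuple_of m a ks = map (\<lambda>i. cw m a (sum_list (take i ks))) [0..<Suc (length ks)]"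

text \<open>
  The bound \<open>k\<^sub>1 + \<dots> + k\<^bsub>s-1\<^esub> \<le> m - d\<close> is written additively, because subtraction on
  \<open>nat\<close> truncates.
\<close>

definition admissible :: "nat \<Rightarrow> nat \<Rightarrow> nat \<Rightarrow> nat list set" where
  "admissible m s d = {tuple_of m a ks | a ks.
     a \<in> spots m \<and> length ks = s - 1 \<and> (\<forall>k \<in> set ks. d \<le> k) \<and> sum_list ks + d \<le> m}"

text \<open>
  The sweep of \<open>park\<close> may start at displacement 0, since it is only reached when the
  last choice is occupied.
\<close>

definition park :: "nat \<Rightarrow> nat set \<Rightarrow> nat list \<Rightarrow> nat" where
  "park m Occ t = (case find (\<lambda>x. x \<notin> Occ) t of
       Some x \<Rightarrow> x
     | None \<Rightarrow> cw m (last t) (LEAST k. cw m (last t) k \<notin> Occ))"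

definition occupied :: "nat \<Rightarrow> nat list list \<Rightarrow> nat set" where
  "occupied m A = foldl (\<lambda>Occ t. insert (park m Occ t) Occ) {} A"

definition circular_preferences :: "nat \<Rightarrow> nat \<Rightarrow> nat \<Rightarrow> nat list list set" where
  "circular_preferences m s d = {A. length A = m - 1 \<and> set A \<subseteq> admissible m s d}"

definition empty_spot :: "nat \<Rightarrow> nat list list \<Rightarrow> nat" where
  "empty_spot m A = (THE j. j \<in> spots m \<and> j \<notin> occupied m A)"

lemma cw_in_spots: "m > 0 \<Longrightarrow> cw m x k \<in> spots m"
  by (simp add: cw_def spots_def Suc_le_eq)

lemma cw_reaches:
  assumes "x \<in> spots m" "y \<in> spots m"
  shows "\<exists>k. cw m x k = y"
proof
  have "x - 1 + (m - x + y) = (y - 1) + m" using assms by (auto simp: spots_def)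
  then have "cw m x (m - x + y) = (y - 1) mod m + 1" by (simp only: cw_def mod_add_self2)
  then show "cw m x (m - x + y) = y" using assms by (auto simp: spots_def)
qed

lemma admissible_spots:
  assumes "m > 0" "t \<in> admissible m s d"
  shows "t \<noteq> []" "set t \<subseteq> spots m"
  using assms by (auto simp: admissible_def tuple_of_def cw_in_spots)

lemma park_free:
  assumes "m > 0" "t \<in> admissible m s d" "Occ \<subset> spots m"
  shows "park m Occ t \<in> spots m - Occ"
proof (cases "find (\<lambda>x. x \<notin> Occ) t")
  case None
  have "last t \<in> spots m"
    using admissible_spots[OF assms(1,2)] last_in_set by blast
  then have "\<exists>k. cw m (last t) k \<notin> Occ"
    using assms(3) cw_reaches by (metis psubset_imp_ex_mem DiffE)
  then have "cw m (last t) (LEAST k. cw m (last t) k \<notin> Occ) \<notin> Occ"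
    by (rule LeastI_ex)
  then show ?thesis using None cw_in_spots[OF assms(1)] by (simp add: park_def)
next
  case (Some x)
  then have "x \<in> set t" "x \<notin> Occ" by (auto simp: find_Some_iff)
  then show ?thesis using Some admissible_spots[OF assms(1,2)] by (auto simp: park_def)
qed

lemma occupied_card:
  assumes "length A < m" "set A \<subseteq> admissible m s d"
  shows "occupied m A \<subseteq> spots m \<and> card (occupied m A) = length A"
  using assms
proof (induction A rule: rev_induct)
  case Nil
  then show ?case by (simp add: occupied_def)
next
  case (snoc t A)
  then have IH: "occupied m A \<subseteq> spots m" "card (occupied m A) = length A" by auto
  have "card (spots m) = m" by (simp add: spots_def)
  then have "occupied m A \<subset> spots m" using IH snoc.prems(1) by auto
  then have "park m (occupied m A) t \<in> spots m - occupied m A"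
    using snoc.prems by (intro park_free) auto
  moreover have "finite (occupied m A)"
    using IH(1) finite_subset by (auto simp: spots_def)
  moreover have "occupied m (A @ [t]) = insert (park m (occupied m A) t) (occupied m A)"
    by (simp add: occupied_def)
  ultimately show ?case using IH by auto
qed

lemma ex1_empty_spot:
  assumes "m \<ge> 2" "A \<in> circular_preferences m s d"
  shows "\<exists>!j. j \<in> spots m \<and> j \<notin> occupied m A"
proof -
  have occ: "occupied m A \<subseteq> spots m" "card (occupied m A) = m - 1"
    using occupied_card[of A m s d] assms by (auto simp: circular_preferences_def)
  have "card (spots m - occupied m A) = 1"
    using assms(1) occ by (subst card_Diff_subset) (auto simp: spots_def intro: finite_subset)
  then obtain x where "spots m - occupied m A = {x}" by (auto simp: card_1_singleton_iff)
  then have "\<And>j. j \<in> spots m \<and> j \<notin> occupied m A \<longleftrightarrow> j = x" by blast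
  then show ?thesis by simp
qed

end

theory Submission
  imports Defs
begin

text \<open>
  Rotating all preferences by \<open>r\<close> rotates the empty spot by \<open>r\<close>, so the fibres of \<open>E\<close> over the
  \<open>m\<close> spots are equinumerous. An admissible tuple determines its anchor and its increments
  (which are smaller than \<open>m\<close>), and the excesses \<open>k\<^sub>i - d\<close>, completed by a slack term, form a
  weak composition of \<open>m - sd\<close> into \<open>s\<close> parts. Hence there are
  \<open>(m * (m-sd+s-1 choose s-1)) ^ n\<close> circular preferences, and each fibre has an \<open>m\<close>-th of them.
\<close>

lemma cw_cw: "cw m (cw m x k) l = cw m x (k + l)"
  by (simp add: cw_def mod_add_left_eq add.assoc)

lemma cw_commute: "cw m (cw m x k) l = cw m (cw m x l) k"
  by (simp add: cw_cw add.commute)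

lemma cw_0: "x \<in> spots m \<Longrightarrow> cw m x 0 = x"
  by (auto simp: cw_def spots_def)

lemma mod_add_left_cancel_nat:
  fixes c k l m :: nat
  assumes "(c + k) mod m = (c + l) mod m"
  shows "k mod m = l mod m"
proof (cases "l \<le> k")
  case True
  then show ?thesis using assms by (simp add: mod_eq_dvd_iff_nat)
next
  case False
  then have "l mod m = k mod m" using assms[symmetric] by (simp add: mod_eq_dvd_iff_nat)
  then show ?thesis ..
qed

lemma inj_on_cw: "inj_on (\<lambda>x. cw m x r) (spots m)"
proof (rule inj_onI)
  fix x y assume xy: "x \<in> spots m" "y \<in> spots m" and "cw m x r = cw m y r"
  then have "(r + (x - 1)) mod m = (r + (y - 1)) mod m" by (simp add: cw_def add.commute)
  then have "(x - 1) mod m = (y - 1) mod m" by (rule mod_add_left_cancel_nat)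
  then show "x = y" using xy by (auto simp: spots_def)
qed

text \<open>A displacement acts only through its residue modulo \<open>m\<close>; the bounds make
  the residue determine it.\<close>

lemma cw_cancel_displacement:
  assumes "cw m a k = cw m a l" "k < m" "l < m"
  shows "k = l"
  using assms mod_add_left_cancel_nat[of "a - 1" k m l] by (simp add: cw_def)

subsection \<open>Rotation\<close>

lemma tuple_of_rotate: "map (\<lambda>x. cw m x r) (tuple_of m a ks) = tuple_of m (cw m a r) ks"
  by (simp add: tuple_of_def cw_cw add.commute)

lemma admissible_rotate:
  assumes "m > 0" "t \<in> admissible m s d"
  shows "map (\<lambda>x. cw m x r) t \<in> admissible m s d"
proof -
  obtain a ks where t: "t = tuple_of m a ks" and "length ks = s - 1" "\<forall>k \<in> set ks. d \<le> k"
      "sum_list ks + d \<le> m"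
    using assms(2) by (auto simp: admissible_def)
  moreover have "cw m a r \<in> spots m" using cw_in_spots[OF assms(1)] .
  ultimately show ?thesis unfolding admissible_def t tuple_of_rotate by blast
qed

text \<open>Parking inspects \<open>Occ\<close> only by testing membership of spots, and rotation,
  being injective on spots, preserves these tests.\<close>

lemma park_rotate:
  assumes "m > 0" "t \<noteq> []" "set t \<subseteq> spots m" "Occ \<subseteq> spots m"
  shows "park m ((\<lambda>x. cw m x r) ` Occ) (map (\<lambda>x. cw m x r) t) = cw m (park m Occ t) r"
proof -
  have mem: "cw m x r \<in> (\<lambda>x. cw m x r) ` Occ \<longleftrightarrow> x \<in> Occ" if "x \<in> spots m" for x
    using inj_on_image_mem_iff[OF inj_on_cw that assms(4)] by simp
  have find: "find (\<lambda>x. x \<notin> (\<lambda>x. cw m x r) ` Occ) (map (\<lambda>x. cw m x r) t)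
      = map_option (\<lambda>x. cw m x r) (find (\<lambda>x. x \<notin> Occ) t)"
    using assms(3) by (induction t) (auto simp: mem)
  \<comment> \<open>Both sweeps meet free spots at the same displacements \<open>k\<close>, so the
    two \<open>LEAST\<close> values agree.\<close>
  have "cw m (cw m x r) k \<in> (\<lambda>x. cw m x r) ` Occ \<longleftrightarrow> cw m x k \<in> Occ" for x k
    using mem[OF cw_in_spots[OF assms(1)]] by (simp add: cw_commute[of m x r])
  then show ?thesis
    unfolding park_def find using assms(2)
    by (auto split: option.split simp: last_map cw_commute[of m _ r])
qed

lemma occupied_rotate:
  assumes "length A < m" "set A \<subseteq> admissible m s d"
  shows "occupied m (map (map (\<lambda>x. cw m x r)) A) = (\<lambda>x. cw m x r) ` occupied m A"
  using assms
proof (induction A rule: rev_induct)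
  case Nil
  then show ?case by (simp add: occupied_def)
next
  case (snoc t A)
  have m: "m > 0" using snoc.prems by simp
  have "occupied m A \<subseteq> spots m" using occupied_card[of A m s d] snoc.prems by simp
  then have "park m ((\<lambda>x. cw m x r) ` occupied m A) (map (\<lambda>x. cw m x r) t)
      = cw m (park m (occupied m A) t) r"
    using snoc.prems admissible_spots[OF m, of t s d] by (intro park_rotate m) auto
  moreover have "occupied m (B @ [u]) = insert (park m (occupied m B) u) (occupied m B)" for B u
    by (simp add: occupied_def)
  ultimately show ?case using snoc by simp
qed

lemma circular_preferences_rotate:
  assumes "m > 0" "A \<in> circular_preferences m s d"
  shows "map (map (\<lambda>x. cw m x r)) A \<in> circular_preferences m s d"
  using assms by (auto simp: circular_preferences_def intro: admissible_rotate)

lemma empty_spot_iff: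
  assumes "m \<ge> 2" "A \<in> circular_preferences m s d"
  shows "empty_spot m A = j \<longleftrightarrow> j \<in> spots m \<and> j \<notin> occupied m A"
  using theI'[OF ex1_empty_spot[OF assms]] ex1_empty_spot[OF assms]
  unfolding empty_spot_def by blast

text \<open>The rotated empty spot avoids the rotated occupied set, and only one spot does.\<close>

lemma empty_spot_rotate:
  assumes "m \<ge> 2" "A \<in> circular_preferences m s d"
  shows "empty_spot m (map (map (\<lambda>x. cw m x r)) A) = cw m (empty_spot m A) r"
proof -
  have m: "m > 0" using assms by simp
  have A: "length A < m" "set A \<subseteq> admissible m s d"
    using assms by (auto simp: circular_preferences_def)
  have "empty_spot m A \<in> spots m" "empty_spot m A \<notin> occupied m A"
    using empty_spot_iff[OF assms] by auto
  then have "cw m (empty_spot m A) r \<notin> (\<lambda>x. cw m x r) ` occupied m A"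
    using inj_on_image_mem_iff[OF inj_on_cw] occupied_card[OF A] by simp
  then show ?thesis
    using empty_spot_iff[OF assms(1) circular_preferences_rotate[OF m assms(2)]]
    by (simp add: occupied_rotate[OF A] cw_in_spots[OF m])
qed

subsection \<open>Counting\<close>

text \<open>The tail is again a tuple, anchored at the second choice; this allows induction on the
  increments. The head is \<open>cw m a 0\<close> because \<open>a\<close> need not be a spot
  here.\<close>

lemma tuple_of_Cons: "tuple_of m a (k # ks) = cw m a 0 # tuple_of m (cw m a k) ks"
proof -
  have "[0..<Suc (length (k # ks))] = 0 # map Suc [0..<Suc (length ks)]"
    \<comment> \<open>\<open>upt_Suc\<close> would split off the last index instead of the
      first.\<close>
    by (simp add: upt_conv_Cons map_Suc_upt del: upt_Suc)
  then show ?thesis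
    by (simp add: tuple_of_def cw_cw del: upt_Suc)
qed

text \<open>The first entry gives the anchor. Consecutive entries give each increment modulo
  \<open>m\<close>, hence exactly, since it is below \<open>m\<close>.\<close>

lemma tuple_of_inject:
  assumes "m > 0" "tuple_of m a ks = tuple_of m b ls" "a \<in> spots m" "b \<in> spots m"
    "\<forall>k \<in> set ks. k < m" "\<forall>k \<in> set ls. k < m"
  shows "a = b \<and> ks = ls"
  using assms
proof (induction ks arbitrary: a b ls)
  case Nil
  then have "length ls = 0"
    by (metis length_map length_upt diff_zero list.size(3) old.nat.inject tuple_of_def)
  then show ?case using Nil by (simp add: tuple_of_def cw_0)
next
  case (Cons k ks)
  show ?case
  proof (cases ls)
    case Nil
    then show ?thesis using Cons.prems(2) by (simp add: tuple_of_def)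
  next
    case (Cons l ls')
    have "a = b" and eq: "tuple_of m (cw m a k) ks = tuple_of m (cw m a l) ls'"
      using Cons.prems unfolding Cons by (auto simp: tuple_of_Cons cw_0)
    have lt: "k < m" "l < m" "\<forall>k \<in> set ks. k < m" "\<forall>k \<in> set ls'. k < m"
      using Cons.prems unfolding Cons by simp_all
    have "cw m a k = cw m a l \<and> ks = ls'"
      using Cons.IH[OF \<open>m > 0\<close> eq] lt \<open>m > 0\<close> by (simp add: cw_in_spots)
    then show ?thesis
      using \<open>a = b\<close> Cons cw_cancel_displacement[of m a k l] lt by simp
  qed
qed

lemma sum_list_map_add_const: "sum_list (map (\<lambda>x. x + d) xs) = sum_list xs + length xs * (d::nat)"
  by (induction xs) auto

text \<open>Stars and bars: the inequality on the sum becomes an equality once a slack term is put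
  in front of the excesses.\<close>

lemma card_increments:
  fixes m s d :: nat
  assumes "s \<ge> 1" "m \<ge> s * d"
  shows "card {ks. length ks = s - 1 \<and> (\<forall>k \<in> set ks. d \<le> k) \<and> sum_list ks + d \<le> m}
    = (m - s * d + s - 1) choose (s - 1)"
    (is "card ?K = _")
proof -
  obtain p where s: "s = Suc p" using assms(1) by (cases s) auto
  let ?L = "{l. length l = s \<and> sum_list l = m - s * d}"
  \<comment> \<open>The head of \<open>l\<close> is the slack; its tail holds the excesses over
    \<open>d\<close>.\<close>
  let ?f = "\<lambda>l. map (\<lambda>x. x + d) (tl l)"
  have "bij_betw ?f ?L ?K"
  proof (rule bij_betwI')
    \<comment> \<open>Equal tails force equal heads because the total is fixed.\<close>
    fix x y assume "x \<in> ?L" "y \<in> ?L"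
    moreover have "inj (\<lambda>x. x + d)" by simp
    ultimately show "(?f x = ?f y) = (x = y)"
      by (cases x; cases y) (auto simp: s)
  next
    fix x assume "x \<in> ?L"
    then show "?f x \<in> ?K"
      using assms(2) by (cases x) (auto simp: s sum_list_map_add_const)
  next
    fix ks assume ks: "ks \<in> ?K"
    \<comment> \<open>Truncated subtraction is harmless here, as every increment is at least
      \<open>d\<close>.\<close>
    define es where "es = map (\<lambda>k. k - d) ks"
    have map: "map (\<lambda>x. x + d) es = ks"
      using ks by (auto simp: es_def intro!: map_idI)
    have "sum_list ks = sum_list es + p * d"
      using ks sum_list_map_add_const[of d es] map by (simp add: es_def s)
    then have "sum_list es \<le> m - s * d" using ks by (auto simp: s)
    then have "(m - s * d - sum_list es) # es \<in> ?L" using ks by (simp add: s es_def)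
    then show "\<exists>x \<in> ?L. ks = ?f x" by (rule bexI[rotated]) (simp add: map)
  qed
  then have "card ?K = card ?L" by (simp add: bij_betw_same_card)
  also have "\<dots> = (m - s * d + s - 1) choose (m - s * d)"
    by (rule card_length_sum_list)
  also have "\<dots> = (m - s * d + s - 1) choose (s - 1)"
    by (subst binomial_symmetric) (auto simp: s)
  finally show ?thesis .
qed

lemma card_admissible:
  assumes "s \<ge> 1" "d \<ge> 1" "m \<ge> 2" "m \<ge> s * d"
  shows "card (admissible m s d) = m * ((m - s * d + s - 1) choose (s - 1))"
proof -
  let ?K = "{ks. length ks = s - 1 \<and> (\<forall>k \<in> set ks. d \<le> k) \<and> sum_list ks + d \<le> m}"
  \<comment> \<open>Each increment is at most \<open>m - d\<close>, which is below \<open>m\<close>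
    because \<open>d \<ge> 1\<close>.\<close>
  have lt: "\<forall>k \<in> set ks. k < m" if "ks \<in> ?K" for ks
  proof
    fix k assume "k \<in> set ks"
    then have "k \<le> sum_list ks" by (simp add: member_le_sum_list)
    then show "k < m" using that assms(2) by simp
  qed
  have "inj_on (\<lambda>(a, ks). tuple_of m a ks) (spots m \<times> ?K)"
  proof (rule inj_onI, clarify)
    fix a ks b ls
    assume "a \<in> spots m" "b \<in> spots m" "tuple_of m a ks = tuple_of m b ls"
      and "length ks = s - 1" "\<forall>k \<in> set ks. d \<le> k" "sum_list ks + d \<le> m"
      and "length ls = s - 1" "\<forall>k \<in> set ls. d \<le> k" "sum_list ls + d \<le> m"
    then show "a = b \<and> ks = ls"
      using assms(3) lt by (intro tuple_of_inject[of m]) simp_all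
  qed
  moreover have "admissible m s d = (\<lambda>(a, ks). tuple_of m a ks) ` (spots m \<times> ?K)"
    by (auto simp: admissible_def)
  ultimately have "card (admissible m s d) = card (spots m \<times> ?K)"
    by (simp add: card_image)
  then show ?thesis
    unfolding card_cartesian_product card_increments[OF assms(1,4)] by (simp add: spots_def)
qed

lemma finite_admissible:
  assumes "m > 0"
  shows "finite (admissible m s d)"
proof -
  \<comment> \<open>The length is \<open>Suc (s - 1)\<close> rather than \<open>s\<close> because
    \<open>s = 0\<close> is allowed here.\<close>
  have "admissible m s d \<subseteq> {t. set t \<subseteq> spots m \<and> length t = Suc (s - 1)}"
    using assms by (auto simp: admissible_def tuple_of_def cw_in_spots)
  then show ?thesis
    by (rule finite_subset) (simp add: finite_lists_length_eq spots_def)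
qed

lemma circular_preferences_eq:
  "circular_preferences m s d = {A. set A \<subseteq> admissible m s d \<and> length A = m - 1}"
  by (auto simp: circular_preferences_def)

lemma finite_circular_preferences: "m > 0 \<Longrightarrow> finite (circular_preferences m s d)"
  by (simp add: circular_preferences_eq finite_lists_length_eq finite_admissible)

text \<open>A rotation taking \<open>i\<close> to \<open>j\<close> embeds one fibre in the other.
  Exchanging \<open>i\<close> and \<open>j\<close> gives the reverse inequality.\<close>

lemma card_empty_spot_le:
  assumes "m \<ge> 2" "i \<in> spots m" "j \<in> spots m"
  shows "card {A \<in> circular_preferences m s d. empty_spot m A = i}
    \<le> card {A \<in> circular_preferences m s d. empty_spot m A = j}" (is "card ?I \<le> card ?J")
proof -
  have m: "m > 0" using assms by simp
  obtain r where r: "cw m i r = j" using cw_reaches[OF assms(2,3)] by blast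
  let ?f = "map (map (\<lambda>x. cw m x r))"
  have fin: "finite ?J" using finite_circular_preferences[OF m] by simp
  \<comment> \<open>Injectivity on spots lifts first to tuples, then to lists of tuples.\<close>
  have "inj_on ?f (lists (lists (spots m)))"
    by (intro inj_on_map_lists inj_on_cw)
  moreover have "?I \<subseteq> lists (lists (spots m))"
    using admissible_spots(2)[OF m] by (fastforce simp: circular_preferences_def)
  ultimately have inj: "inj_on ?f ?I" by (rule inj_on_subset)
  have "?f ` ?I \<subseteq> ?J"
    using circular_preferences_rotate[OF m] empty_spot_rotate[OF assms(1)] r by auto
  then show ?thesis using card_inj_on_le[OF inj _ fin] by simp
qed

theorem theorem1:
  fixes s d m n j :: nat
  assumes "s \<ge> 1" and "d \<ge> 1" and "m \<ge> 2" and "m \<ge> s * d" and "n = m - 1"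
    and "j \<in> spots m"
  shows "card {A \<in> circular_preferences m s d. empty_spot m A = j}
       = m ^ (n - 1) * ((m - s * d + s - 1) choose (s - 1)) ^ n"
proof -
  let ?F = "\<lambda>i. {A \<in> circular_preferences m s d. empty_spot m A = i}"
  let ?b = "(m - s * d + s - 1) choose (s - 1)"
  have fin: "finite (admissible m s d)" using assms by (simp add: finite_admissible)
  have finC: "finite (circular_preferences m s d)"
    using assms by (simp add: finite_circular_preferences)
  have "(m * ?b) ^ n = card (circular_preferences m s d)"
    using fin card_admissible[OF assms(1-4)] assms(5)
    by (simp add: circular_preferences_eq card_lists_length_eq)
  \<comment> \<open>The fibres cover everything because the empty spot always lies in
    \<open>spots m\<close>.\<close>
  also have "circular_preferences m s d = (\<Union>i \<in> spots m. ?F i)"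
    using empty_spot_iff[OF assms(3)] by blast
  also have "card \<dots> = (\<Sum>i \<in> spots m. card (?F i))"
    using finC by (intro card_UN_disjoint) (auto simp: spots_def)
  also have "\<dots> = (\<Sum>i \<in> spots m. card (?F j))"
    using card_empty_spot_le assms(3,6) by (intro sum.cong refl order.antisym) auto
  also have "\<dots> = m * card (?F j)" by (simp add: spots_def)
  finally have eq: "m * card (?F j) = (m * ?b) ^ n" by simp
  \<comment> \<open>As \<open>m \<ge> 2\<close>, \<open>n\<close> is positive, so a factor
    \<open>m\<close> can be split off \<open>(m * ?b) ^ n\<close> and cancelled.\<close>
  have n: "n = Suc (n - 1)" using assms(3,5) by simp
  have "m * card (?F j) = m * (m ^ (n - 1) * ?b ^ n)"
    unfolding eq by (subst (1 3) n) (simp add: power_mult_distrib)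
  then show ?thesis using assms(3) by simp
qed

end
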